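(* Let $M\in\mathbb{R}^{n\times m}$ be a (left) stochastic matrix with $\operatorname{rank}M=r$. Then \[B_3(M)\le (\ln m+1)^2r^2,\qquad\text{where}\qquad B_3(M)=\max_{q}\frac{1}{\sum_{i,j=1}^m q_iq_jF(M_i,M_j)^2},\] the maximum being over all probability distributions $q=(q_1,\dots,q_m)$ and $M_i$ denoting the $i$-th column of $M$.
   Context: A (left) stochastic matrix is a matrix with nonnegative entries whose columns each sum to $1$; thus each column is a probability distribution. For probability distributions $p=(p_k)_{k=1}^n$, $q=(q_k)_{k=1}^n$, the fidelity is $F(p,q)=\sum_{k=1}^n\sqrt{p_kq_k}$. $\ln$ is the natural logarithm. *)

theory Defs
  imports "HOL-Analysis.Analysis"
begin

definition prob_dist :: "real ^ 'n \<Rightarrow> bool" where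
  "prob_dist p \<longleftrightarrow> (\<forall>k. 0 \<le> p $ k) \<and> (\<Sum>k\<in>UNIV. p $ k) = 1"

(* An n-by-m matrix is of type real ^ 'm ^ 'n, with M $ k $ i the entry in row k and column i. *)
definition left_stochastic :: "real ^ 'm ^ 'n \<Rightarrow> bool" where
  "left_stochastic M \<longleftrightarrow>
     (\<forall>k i. 0 \<le> M $ k $ i) \<and> (\<forall>i. (\<Sum>k\<in>UNIV. M $ k $ i) = 1)"

definition fidelity :: "real ^ 'n \<Rightarrow> real ^ 'n \<Rightarrow> real" where
  "fidelity p q = (\<Sum>k\<in>UNIV. sqrt (p $ k * q $ k))"

definition B3_objective :: "real ^ 'm ^ 'n \<Rightarrow> real ^ 'm \<Rightarrow> real" where
  "B3_objective M q =
     1 / (\<Sum>i\<in>UNIV. \<Sum>j\<in>UNIV. q $ i * q $ j * (fidelity (column i M) (column j M))\<^sup>2)"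

(* GREATEST is the maximum of the set of values, and not merely its supremum; it is
   meaningful because the maximum is attained (B3_is_max). *)
definition B3 :: "real ^ 'm ^ 'n \<Rightarrow> real" where
  "B3 M = (GREATEST v. \<exists>q. prob_dist q \<and> v = B3_objective M q)"

lemma fidelity_column_self:
  assumes "left_stochastic M"
  shows "fidelity (column i M) (column i M) = 1"
  using assms by (simp add: fidelity_def column_def left_stochastic_def)

lemma B3_denominator_pos:
  assumes M: "left_stochastic M" and q: "prob_dist q"
  shows "0 < (\<Sum>i\<in>UNIV. \<Sum>j\<in>UNIV. q $ i * q $ j * (fidelity (column i M) (column j M))\<^sup>2)"
proof -
  have nn: "0 \<le> q $ k" for k
    using q by (simp add: prob_dist_def)
  obtain i where i: "q $ i \<noteq> 0"
    using q by (force simp: prob_dist_def)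
  have t: "0 \<le> q $ i * q $ j * (fidelity (column i M) (column j M))\<^sup>2" for i j
    by (simp add: nn)
  have d: "0 < q $ i * q $ i * (fidelity (column i M) (column i M))\<^sup>2"
    using i nn[of i] by (simp add: fidelity_column_self[OF M])
  have s: "0 < (\<Sum>j\<in>UNIV. q $ i * q $ j * (fidelity (column i M) (column j M))\<^sup>2)"
    by (rule sum_pos2[of UNIV i]) (use d t in auto)
  show ?thesis
    by (rule sum_pos2[of UNIV i]) (use s t in \<open>auto intro: sum_nonneg\<close>)
qed

lemma compact_prob_dist: "compact {q :: real ^ 'm. prob_dist q}"
proof -
  have eq: "{q :: real ^ 'm. prob_dist q} =
      {q. \<forall>k. 0 \<le> q $ k} \<inter> {q. (\<Sum>k\<in>UNIV. q $ k) = 1}"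
    by (auto simp: prob_dist_def)
  have "closed {q :: real ^ 'm. prob_dist q}"
    unfolding eq by (intro closed_Int closed_Collect_all closed_Collect_le closed_Collect_eq
        continuous_intros)
  moreover have "norm q \<le> 1" if "prob_dist q" for q :: "real ^ 'm"
    using norm_le_l1_cart[of q] that by (simp add: prob_dist_def)
  then have "bounded {q :: real ^ 'm. prob_dist q}"
    by (auto simp: bounded_iff)
  ultimately show ?thesis
    by (simp add: compact_eq_bounded_closed)
qed

lemma B3_is_max:
  fixes M :: "real ^ 'm ^ 'n"
  assumes M: "left_stochastic M"
  shows "\<exists>q. prob_dist q \<and> B3 M = B3_objective M q"
    and "prob_dist q \<Longrightarrow> B3_objective M q \<le> B3 M"
proof -
  let ?S = "{q :: real ^ 'm. prob_dist q}"
  have "prob_dist (axis (undefined :: 'm) 1)"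
    by (simp add: prob_dist_def axis_def)
  then have "?S \<noteq> {}"
    by blast
  moreover have "continuous_on ?S (B3_objective M)"
    unfolding B3_objective_def
    by (intro continuous_intros ballI) (use B3_denominator_pos[OF M] in force)
  ultimately obtain q0 where q0: "prob_dist q0"
    "\<And>q. prob_dist q \<Longrightarrow> B3_objective M q \<le> B3_objective M q0"
    using continuous_attains_sup[OF compact_prob_dist] by blast
  have eq: "B3 M = B3_objective M q0"
    unfolding B3_def by (rule Greatest_equality) (use q0 in auto)
  show "\<exists>q. prob_dist q \<and> B3 M = B3_objective M q"
    using eq q0(1) by blast
  show "prob_dist q \<Longrightarrow> B3_objective M q \<le> B3 M"
    using eq q0(2) by simp
qed

end

theory Submission
  imports Defs
begin

text \<open>
  Among the columns of \<open>M\<close> choose a basis of maximal volume. By Cramer's rule every column has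
  coefficients in \<open>[-1, 1]\<close> with respect to it, so the sum \<open>S\<close> of the basis columns dominates all
  columns entrywise, and \<open>S\<close> has total mass \<open>r\<close>. Since \<open>M k i \<le> sqrt (S k) * sqrt (M k i)\<close>, two
  applications of Cauchy-Schwarz give, for \<open>T\<close> the \<open>q\<close>-average of \<open>F (M i) (M j)\<close>,
  first \<open>1 \<le> r * T\<close> and then that the \<open>q\<close>-average of \<open>(F (M i) (M j))\<^sup>2\<close> is at least
  \<open>T\<^sup>2 \<ge> 1 / r\<^sup>2\<close>. The logarithmic factor only weakens the resulting bound \<open>B3 M \<le> r\<^sup>2\<close>.
\<close>

text \<open>The vectors \<open>v j\<close> need not span the space, so volume is measured by a
  square determinant: a choice of \<open>v (h i)\<close> for \<open>i\<close> in \<open>I\<close> is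
  completed by fixed vectors. A choice that maximises its absolute value yields the coefficients.
  The chosen vectors are indexed by rows, hence \<open>I\<close> is a set over
  \<open>'n\<close>.\<close>

lemma exists_basis_coefficients_le_1:
  fixes v :: "'m::finite \<Rightarrow> real ^ 'n"
  obtains I :: "'n set" and h :: "'n \<Rightarrow> 'm" where
    "card I = dim (range v)"
    "\<And>j. \<exists>c. (\<forall>i. \<bar>c i\<bar> \<le> 1) \<and> v j = (\<Sum>i\<in>I. c i *\<^sub>R v (h i))"
proof -
  obtain B where B: "B \<subseteq> range v" "independent B" "card B = dim (range v)"
    using basis_exists[of "range v"] by metis
  obtain E where E: "B \<subseteq> E" "independent E" "UNIV \<subseteq> span E"
    using maximal_independent_subset_extend[OF subset_UNIV B(2)] by metis
  have finE: "finite E" and cardE: "card E = CARD('n)"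
    using finiteI_independent[OF E(2)] dim_eq_card[of E UNIV] E by (auto simp: top.extremum_unique)
  obtain g :: "'n \<Rightarrow> real ^ 'n" where g: "bij_betw g UNIV E"
    using finite_same_card_bij[of "UNIV :: 'n set" E] finE cardE by auto
  define I where "I = g -` B"
  have "g ` I = B"
    using g E(1) by (auto simp: I_def bij_betw_def)
  moreover have "inj_on g I"
    using g by (auto simp: bij_betw_def intro: inj_on_subset)
  ultimately have cardI: "card I = dim (range v)"
    using B(3) card_image by metis
  \<comment> \<open>Rows outside \<open>I\<close> keep the vectors of \<open>E - B\<close> for every
    \<open>h\<close>; only the rows in \<open>I\<close> vary.\<close>
  define f where "f h i = (if i \<in> I then v (h i) else g i)" for h i
  define A where "A h = (\<chi> i. f h i)" for h
  have row_A: "row i (A h) = f h i" for h i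
    by (simp add: A_def row_def vec_eq_iff)
  have rows_A: "rows (A h) = range (f h)" for h
    by (auto simp: rows_def row_A)
  obtain h where h: "\<And>h'. \<bar>det (A h')\<bar> \<le> \<bar>det (A h)\<bar>"
  proof -
    let ?D = "range (\<lambda>h. \<bar>det (A h)\<bar>)"
    have "Max ?D \<in> ?D" by (intro Max_in) auto
    then obtain h where "Max ?D = \<bar>det (A h)\<bar>" by (rule rangeE)
    then have "\<bar>det (A h')\<bar> \<le> \<bar>det (A h)\<bar>" for h'
      by (metis Max_ge finite finite_imageI rangeI)
    then show ?thesis using that by blast
  qed
  \<comment> \<open>The choice \<open>h0\<close> reproduces the basis \<open>E\<close> itself, so
    the maximal determinant is nonzero.\<close>
  have "\<forall>i\<in>I. \<exists>j. g i = v j"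
    using B(1) by (auto simp: I_def)
  then obtain h0 where "\<And>i. i \<in> I \<Longrightarrow> g i = v (h0 i)"
    by metis
  then have "f h0 = g"
    by (auto simp: f_def)
  then have "rows (A h0) = E"
    using g by (simp add: rows_A bij_betw_def)
  then have "rank (A h0) = CARD('n)"
    by (simp add: row_rank_def dim_eq_card_independent[OF E(2)] cardE)
  then have "det (A h0) \<noteq> 0"
    by (simp add: det_eq_0_rank)
  then have det: "det (A h) \<noteq> 0"
    using h[of h0] by auto
  then have dim_f: "dim (range (f h)) = CARD('n)"
    using rank_bound[of "A h"] by (simp add: det_eq_0_rank row_rank_def rows_A)
  have "card (range (f h)) = CARD('n)"
    using dim_le_card'[of "range (f h)"] card_image_le[of UNIV "f h"] dim_f by simp
  then have inj: "inj (f h)"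
    by (simp add: inj_on_iff_eq_card)
  have "independent (range (f h))"
    by (metis card_eq_dim dim_f \<open>card (range (f h)) = CARD('n)\<close> finite finite_imageI
        order_refl span_superset)
  then have ind: "independent (f h ` I)"
    by (rule independent_mono) auto
  have "range v \<subseteq> span (f h ` I)"
  proof (rule card_ge_dim_independent[OF _ ind])
    show "f h ` I \<subseteq> range v" by (auto simp: f_def)
    show "dim (range v) \<le> card (f h ` I)"
      using cardI inj by (metis card_image inj_on_subset order_refl subset_UNIV)
  qed
  then have v_span: "v j \<in> span (f h ` I)" for j by auto
  have "\<exists>c. (\<forall>i. \<bar>c i\<bar> \<le> 1) \<and> v j = (\<Sum>i\<in>I. c i *\<^sub>R v (h i))" for j
  proof -
    obtain u where u: "v j = (\<Sum>w\<in>f h ` I. u w *\<^sub>R w)"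
      using v_span[of j] by (auto simp: span_finite)
    \<comment> \<open>The zero entries off \<open>I\<close> make \<open>x\<close> the coordinate
      vector of \<open>v j\<close> with respect to all rows of \<open>A h\<close>.\<close>
    define x :: "real ^ 'n" where "x = (\<chi> i. if i \<in> I then u (f h i) else 0)"
    have vj: "v j = (\<Sum>i\<in>I. x $ i *\<^sub>R v (h i))"
      unfolding u using inj
      by (subst sum.reindex) (auto simp: x_def f_def intro: inj_on_subset sum.cong)
    also have "\<dots> = (\<Sum>i\<in>UNIV. x $ i *s row i (A h))"
      by (rule sum.mono_neutral_cong_left)
        (auto simp: x_def row_A f_def scalar_mult_eq_scaleR)
    finally have vj': "v j = (\<Sum>i\<in>UNIV. x $ i *s row i (A h))" .
    have "\<bar>x $ k\<bar> \<le> 1" for k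
    proof (cases "k \<in> I")
      case True
      \<comment> \<open>Putting \<open>v j\<close> in row \<open>k\<close> is again an admissible
        choice; by Cramer it multiplies the determinant by \<open>x $ k\<close>, so maximality
        bounds this factor.\<close>
      have "A (h(k := j)) = (\<chi> i. if i = k then (\<Sum>i\<in>UNIV. x $ i *s row i (A h)) else row i (A h))"
        unfolding vj'[symmetric] unfolding row_A by (auto simp: A_def f_def True vec_eq_iff)
      then have "det (A (h(k := j))) = x $ k * det (A h)"
        by (simp add: cramer_lemma_transpose)
      then show ?thesis
        using h[of "h(k := j)"] det by (simp add: abs_mult)
    qed (simp add: x_def)
    with vj show ?thesis by blast
  qed
  with cardI show ?thesis using that by blast
qed

lemma stochastic_entries_dominated:
  fixes M :: "real ^ 'm ^ 'n"
  assumes M: "left_stochastic M"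
  obtains S :: "'n \<Rightarrow> real" where "\<And>k i. M $ k $ i \<le> S k" "(\<Sum>k\<in>UNIV. S k) = real (rank M)"
proof -
  have nn: "0 \<le> M $ k $ i" and one: "(\<Sum>k\<in>UNIV. M $ k $ i) = 1" for k i
    using M by (auto simp: left_stochastic_def)
  obtain I :: "'n set" and h where
    I: "card I = dim (range (\<lambda>i. column i M))" and
    c: "\<And>j. \<exists>c. (\<forall>i. \<bar>c i\<bar> \<le> 1) \<and> column j M = (\<Sum>i\<in>I. c i *\<^sub>R column (h i) M)"
    using exists_basis_coefficients_le_1[of "\<lambda>i. column i M"] by blast
  have "range (\<lambda>i. column i M) = columns M"
    by (auto simp: columns_def)
  then have cardI: "card I = rank M"
    using I by (simp add: column_rank_def)
  define S where "S k = (\<Sum>l\<in>I. M $ k $ h l)" for k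
  show thesis
  proof
    fix k j
    obtain c where "\<And>i. \<bar>c i\<bar> \<le> 1" and cj: "column j M = (\<Sum>i\<in>I. c i *\<^sub>R column (h i) M)"
      using c by blast
    then have "c i \<le> 1" for i
      by (simp add: abs_le_iff)
    then have "(\<Sum>l\<in>I. c l * M $ k $ h l) \<le> S k"
      unfolding S_def using nn by (intro sum_mono) (metis mult_1 mult_right_mono)
    moreover have "M $ k $ j = (\<Sum>l\<in>I. c l * M $ k $ h l)"
      using arg_cong[OF cj, of "\<lambda>x. x $ k"] by (simp add: column_def)
    ultimately show "M $ k $ j \<le> S k" by simp
  next
    have "(\<Sum>k\<in>UNIV. S k) = (\<Sum>l\<in>I. \<Sum>k\<in>UNIV. M $ k $ h l)"
      unfolding S_def by (rule sum.swap)
    then show "(\<Sum>k\<in>UNIV. S k) = real (rank M)"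
      by (simp add: one cardI)
  qed
qed

text \<open>Fidelity is the inner product of entrywise square roots, so its average is the squared
  norm of the averaged square-root vector.\<close>

lemma average_fidelity_eq_sum_squares:
  fixes M :: "real ^ 'm ^ 'n"
  shows "(\<Sum>i\<in>UNIV. \<Sum>j\<in>UNIV. q $ i * q $ j * fidelity (column i M) (column j M)) =
    (\<Sum>k\<in>UNIV. (\<Sum>i\<in>UNIV. q $ i * sqrt (M $ k $ i))\<^sup>2)"
proof -
  have "(\<Sum>k\<in>UNIV. (\<Sum>i\<in>UNIV. q $ i * sqrt (M $ k $ i))\<^sup>2) =
      (\<Sum>k\<in>UNIV. \<Sum>i\<in>UNIV. \<Sum>j\<in>UNIV. q $ i * q $ j * sqrt (M $ k $ i * M $ k $ j))"
    by (simp add: power2_eq_square sum_product real_sqrt_mult mult_ac)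
  also have "\<dots> = (\<Sum>i\<in>UNIV. \<Sum>k\<in>UNIV. \<Sum>j\<in>UNIV. q $ i * q $ j * sqrt (M $ k $ i * M $ k $ j))"
    by (rule sum.swap)
  also have "\<dots> = (\<Sum>i\<in>UNIV. \<Sum>j\<in>UNIV. \<Sum>k\<in>UNIV. q $ i * q $ j * sqrt (M $ k $ i * M $ k $ j))"
    by (rule sum.cong[OF refl], rule sum.swap)
  finally show ?thesis
    by (simp add: fidelity_def column_def sum_distrib_left)
qed

lemma average_fidelity_ge:
  fixes M :: "real ^ 'm ^ 'n"
  assumes M: "left_stochastic M" and q: "prob_dist q"
  shows "1 \<le> real (rank M) *
    (\<Sum>i\<in>UNIV. \<Sum>j\<in>UNIV. q $ i * q $ j * fidelity (column i M) (column j M))"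
proof -
  have nn: "0 \<le> M $ k $ i" and one: "(\<Sum>k\<in>UNIV. M $ k $ i) = 1" for k i
    using M by (auto simp: left_stochastic_def)
  have q0: "0 \<le> q $ i" and q1: "(\<Sum>i\<in>UNIV. q $ i) = 1" for i
    using q by (auto simp: prob_dist_def)
  obtain S where S: "\<And>k i. M $ k $ i \<le> S k" "(\<Sum>k\<in>UNIV. S k) = real (rank M)"
    using stochastic_entries_dominated[OF M] by blast
  have S0: "0 \<le> S k" for k
    using nn S(1) order_trans by blast
  define b where "b k = (\<Sum>i\<in>UNIV. q $ i * sqrt (M $ k $ i))" for k
  have le: "(\<Sum>i\<in>UNIV. q $ i * M $ k $ i) \<le> sqrt (S k) * b k" for k
  proof -
    \<comment> \<open>Only one of the two factors \<open>sqrt (M $ k $ i)\<close> is enlarged; the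
      other is kept to form \<open>b k\<close>.\<close>
    have "M $ k $ i \<le> sqrt (S k) * sqrt (M $ k $ i)" for i
      using mult_right_mono[of "sqrt (M $ k $ i)" "sqrt (S k)" "sqrt (M $ k $ i)"] S(1)[of k i]
      by (simp add: nn)
    then have "(\<Sum>i\<in>UNIV. q $ i * M $ k $ i) \<le> (\<Sum>i\<in>UNIV. q $ i * (sqrt (S k) * sqrt (M $ k $ i)))"
      by (intro sum_mono mult_left_mono q0)
    then show ?thesis
      by (simp add: b_def sum_distrib_left mult_ac)
  qed
  have "(\<Sum>k\<in>UNIV. \<Sum>i\<in>UNIV. q $ i * M $ k $ i) = (\<Sum>i\<in>UNIV. \<Sum>k\<in>UNIV. q $ i * M $ k $ i)"
    by (rule sum.swap)
  then have "(\<Sum>k\<in>UNIV. \<Sum>i\<in>UNIV. q $ i * M $ k $ i) = 1"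
    by (simp add: one q1 flip: sum_distrib_left)
  moreover have "(\<Sum>k\<in>UNIV. \<Sum>i\<in>UNIV. q $ i * M $ k $ i) \<le> (\<Sum>k\<in>UNIV. sqrt (S k) * b k)"
    by (intro sum_mono le)
  ultimately have "1 \<le> (\<Sum>k\<in>UNIV. sqrt (S k) * b k)\<^sup>2"
    by simp
  \<comment> \<open>The first factor is the total mass of \<open>S\<close>, the rank; the second is
    the average fidelity.\<close>
  also have "\<dots> \<le> (\<Sum>k\<in>UNIV. (sqrt (S k))\<^sup>2) * (\<Sum>k\<in>UNIV. (b k)\<^sup>2)"
    by (rule Cauchy_Schwarz_ineq_sum)
  finally show ?thesis
    by (simp add: S0 S(2) average_fidelity_eq_sum_squares b_def)
qed

text \<open>Jensen's inequality for the square, from Cauchy-Schwarz with each weight split into two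
  square roots.\<close>

lemma weighted_average_squared_le:
  fixes w x :: "'a \<Rightarrow> real"
  assumes "\<And>i. i \<in> A \<Longrightarrow> 0 \<le> w i" "sum w A = 1"
  shows "(\<Sum>i\<in>A. w i * x i)\<^sup>2 \<le> (\<Sum>i\<in>A. w i * (x i)\<^sup>2)"
proof -
  have "(\<Sum>i\<in>A. w i * x i) = (\<Sum>i\<in>A. sqrt (w i) * (sqrt (w i) * x i))"
    using assms(1) by (intro sum.cong) (auto simp flip: mult.assoc)
  moreover have "(\<Sum>i\<in>A. (sqrt (w i))\<^sup>2) = 1"
    using assms by simp
  moreover have "(\<Sum>i\<in>A. (sqrt (w i) * x i)\<^sup>2) = (\<Sum>i\<in>A. w i * (x i)\<^sup>2)"
    using assms(1) by (intro sum.cong) (auto simp: power_mult_distrib)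
  ultimately show ?thesis
    using Cauchy_Schwarz_ineq_sum[of "\<lambda>i. sqrt (w i)" "\<lambda>i. sqrt (w i) * x i" A] by simp
qed

lemma B3_objective_le_rank_squared:
  fixes M :: "real ^ 'm ^ 'n"
  assumes M: "left_stochastic M" and q: "prob_dist q"
  shows "B3_objective M q \<le> (real (rank M))\<^sup>2"
proof -
  let ?F = "\<lambda>i j. fidelity (column i M) (column j M)"
  define T where "T = (\<Sum>i\<in>UNIV. \<Sum>j\<in>UNIV. q $ i * q $ j * ?F i j)"
  define D where "D = (\<Sum>i\<in>UNIV. \<Sum>j\<in>UNIV. q $ i * q $ j * (?F i j)\<^sup>2)"
  \<comment> \<open>The products \<open>q $ i * q $ j\<close> are probability weights on pairs, so
    Jensen applies to the double sum.\<close>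
  have "(\<Sum>(i, j)\<in>UNIV. q $ i * q $ j) = (\<Sum>i\<in>UNIV. q $ i) * (\<Sum>j\<in>UNIV. q $ j)"
    by (simp add: sum_product sum.cartesian_product)
  then have "T\<^sup>2 \<le> D"
    using weighted_average_squared_le[of UNIV "\<lambda>(i, j). q $ i * q $ j" "\<lambda>(i, j). ?F i j"] q
    by (simp add: T_def D_def prob_dist_def sum.cartesian_product case_prod_beta)
  have "1 \<le> real (rank M) * T"
    using average_fidelity_ge[OF M q] by (simp add: T_def)
  then have "1 \<le> (real (rank M) * T)\<^sup>2"
    by simp
  also have "\<dots> \<le> (real (rank M))\<^sup>2 * D"
    using \<open>T\<^sup>2 \<le> D\<close> by (simp add: power_mult_distrib mult_left_mono)
  finally show ?thesis
    using B3_denominator_pos[OF M q] by (simp add: B3_objective_def D_def divide_le_eq)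
qed

theorem theorem2:
  fixes M :: "real ^ 'm ^ 'n" and r :: nat
  assumes "left_stochastic M"
    and "rank M = r"
  shows "B3 M \<le> (ln (real CARD('m)) + 1)\<^sup>2 * (real r)\<^sup>2"
proof -
  have "0 \<le> ln (real CARD('m))"
    using zero_less_card_finite[where 'a = 'm] by (intro ln_ge_zero) linarith
  then have "1 \<le> (ln (real CARD('m)) + 1)\<^sup>2"
    by simp
  then have "(real r)\<^sup>2 \<le> (ln (real CARD('m)) + 1)\<^sup>2 * (real r)\<^sup>2"
    by (simp add: mult_le_cancel_right1)
  moreover have "B3 M \<le> (real r)\<^sup>2"
    using B3_is_max(1)[OF assms(1)] B3_objective_le_rank_squared[OF assms(1)] assms(2) by auto
  ultimately show ?thesis by linarith
qed

end
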